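(* Let $(\mathcal X,\mathcal E)$ be a $\mathbb Z^d$-periodic connected graph and $F$ an admissible cost function (as in the context). Let $1\le p<\infty$ and suppose that for all $m\in\mathbb R_+^{\mathcal X}$ and $J\in\mathbb R_a^{\mathcal E}$: (i) $F(\lambda m,\lambda J)=\lambda F(m,J)$ for all $\lambda\ge0$; (ii) $F(m,\lambda J)=|\lambda|^pF(m,J)$ for all $\lambda\in\mathbb R$. Then there is a norm $\|\cdot\|$ on $\mathbb R^d$ such that $f_{\rm hom}(\rho,j)=\dfrac{\|j\|^p}{\rho^{p-1}}$ for all $\rho>0$ and $j\in\mathbb R^d$.
   Context: **Graph.** $\mathcal X=\mathbb Z^d\times V$ with $V$ a finite nonempty set; for $x=(z,v)$ write $x_{\mathsf z}=z$. The edge set $\mathcal E\subseteq\mathcal X\times\mathcal X$ is symmetric and $\mathbb Z^d$-periodic (invariant under the shifts $(z,v)\mapsto(\bar z+z,v)$ applied to both endpoints); $(\mathcal X,\mathcal E)$ is connected, locally finite, of bounded degree; $x\sim y$ means $(x,y)\in\mathcal E$. $R_0=\max_{(x,y)\in\mathcal E}|x_{\mathsf z}-y_{\mathsf z}|_{\infty}$. $\mathcal X^Q=\{x\in\mathcal X:x_{\mathsf z}=0\}$, $\mathcal E^Q=\{(x,y)\in\mathcal E:x_{\mathsf z}=0\}$. $\mathbb R_+=[0,\infty)$; $\mathbb R_a^{\mathcal E}$: antisymmetric functions $J:\mathcal E\to\mathbb R$; $\operatorname{div}J(x)=\sum_{y\sim x}J(x,y)$. **Admissible cost.** $F:\mathbb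 R_+^{\mathcal X}\times\mathbb R_a^{\mathcal E}\to\mathbb R\cup\{+\infty\}$ satisfies: (a) convex and lower semicontinuous; (b) local: there is $R_1<\infty$ such that $F(m,J)=F(m',J')$ whenever $m=m'$ on $\{|x_{\mathsf z}|_\infty\le R_1\}$ and $J=J'$ on $\{(x,y)\in\mathcal E:|x_{\mathsf z}|_\infty,|y_{\mathsf z}|_\infty\le R_1\}$; (c) there are $c>0$, $C<\infty$ with $F(m,J)\ge c\sum_{(x,y)\in\mathcal E^Q}|J(x,y)|-C\big(1+\sum_{|x_{\mathsf z}|_\infty\le R}m(x)\big)$, $R=\max\{R_0,R_1\}$; (d) there are a $\mathbb Z^d$-periodic $m^\circ\in\mathbb R_+^{\mathcal X}$ and a $\mathbb Z^d$-periodic divergence-free $J^\circ\in\mathbb R_a^{\mathcal E}$ with $(m^\circ,J^\circ)\in\mathsf D(F)^\circ$, where $\mathsf D(F)=\{F<\infty\}$ and the interior is taken in the finite-dimensional Euclidean space of the finitely many parameters on which $F$ depends. **Homogenised density.** For $\rho\in\mathbb R_+$, $j\in\mathbb R^d$, $\mathsf{Rep}(\rho,j)$ is the set of $\mathbb Z^d$-periodic pairs $(m,J)\in\mathbb R_+^{\mathcal X}\times\mathbb R_a^{\mathcal E}$ with $\sum_{x\in\mathcal X^Q}m(x)=\rho$, $\operatorname{div}J\equiv0$ and $\frac12\sum_{(x,y)\in\mathcal E^Q}J(x,y)(y_{\mathsf z}-x_{\mathsf z})=j$; $f_{\rm hom}(\rho,j)=\inf\{F(m,J):(m,J)\in\mathsf{Rep}(\rho,j)\}$.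 Convention: $0\cdot(+\infty)=0$. *)

theory Defs
  imports "HOL-Analysis.Analysis"
begin

type_synonym ('d, 'v) vertex = "(int ^ 'd::finite) \<times> 'v"

definition real_vec :: "int ^ 'd::finite \<Rightarrow> real ^ 'd" where
  "real_vec z = (\<chi> i. real_of_int (z $ i))"

definition linf :: "int ^ 'd::finite \<Rightarrow> real" where
  "linf z = infnorm (real_vec z)"

definition shift :: "int ^ 'd::finite \<Rightarrow> ('d, 'v::finite) vertex \<Rightarrow> ('d, 'v) vertex" where
  "shift z x = (z + fst x, snd x)"

definition periodic_graph :: "('d::finite, 'v::finite) vertex rel \<Rightarrow> bool" where
  "periodic_graph E \<longleftrightarrow>
     sym E \<and>
     (\<forall>z x y. (x, y) \<in> E \<longrightarrow> (shift z x, shift z y) \<in> E) \<and>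
     (\<forall>x y. (x, y) \<in> E\<^sup>*) \<and>
     (\<forall>x. finite {y. (x, y) \<in> E}) \<and>
     (\<exists>D. \<forall>x. card {y. (x, y) \<in> E} \<le> D)"

text \<open>For a graph satisfying \<^const>\<open>periodic_graph\<close>, the set under the maximum is finite (by local
  finiteness and periodicity) and nonempty (by connectedness).\<close>

definition edge_range :: "('d::finite, 'v::finite) vertex rel \<Rightarrow> real" where
  "edge_range E = Max ((\<lambda>(x, y). linf (fst x - fst y)) ` E)"

definition cell_vertices :: "('d::finite, 'v::finite) vertex set" where
  "cell_vertices = {x. fst x = 0}"

definition cell_edges :: "('d::finite, 'v::finite) vertex rel \<Rightarrow> ('d, 'v) vertex rel" where
  "cell_edges E = {(x, y) \<in> E. fst x = 0}"

text \<open>A function on the edge set is represented by its extension by zero to all pairs of vertices,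
  so that the antisymmetric functions form a linear space.\<close>

definition masses :: "(('d::finite, 'v::finite) vertex \<Rightarrow> real) set" where
  "masses = {m. \<forall>x. 0 \<le> m x}"

definition flows :: "('d::finite, 'v::finite) vertex rel
    \<Rightarrow> (('d, 'v) vertex \<times> ('d, 'v) vertex \<Rightarrow> real) set" where
  "flows E = {J. (\<forall>x y. (x, y) \<notin> E \<longrightarrow> J (x, y) = 0) \<and> (\<forall>x y. J (y, x) = - J (x, y))}"

definition divergence :: "('d::finite, 'v::finite) vertex rel
    \<Rightarrow> (('d, 'v) vertex \<times> ('d, 'v) vertex \<Rightarrow> real) \<Rightarrow> ('d, 'v) vertex \<Rightarrow> real" where
  "divergence E J x = (\<Sum>y | (x, y) \<in> E. J (x, y))"

definition periodic_mass :: "(('d::finite, 'v::finite) vertex \<Rightarrow> real) \<Rightarrow> bool" where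
  "periodic_mass m \<longleftrightarrow> (\<forall>z x. m (shift z x) = m x)"

definition periodic_flow :: "(('d::finite, 'v::finite) vertex \<times> ('d, 'v) vertex \<Rightarrow> real) \<Rightarrow> bool" where
  "periodic_flow J \<longleftrightarrow> (\<forall>z x y. J (shift z x, shift z y) = J (x, y))"

type_synonym ('d, 'v) cost =
  "(('d, 'v) vertex \<Rightarrow> real) \<times> (('d, 'v) vertex \<times> ('d, 'v) vertex \<Rightarrow> real) \<Rightarrow> ereal"

text \<open>A cost is only considered on \<^term>\<open>masses \<times> flows E\<close>; its values elsewhere are irrelevant.\<close>

definition convex_cost :: "('d::finite, 'v::finite) vertex rel \<Rightarrow> ('d, 'v) cost \<Rightarrow> bool" where
  "convex_cost E F \<longleftrightarrow>
     (\<forall>m\<in>masses. \<forall>m'\<in>masses. \<forall>J\<in>flows E. \<forall>J'\<in>flows E. \<forall>t::real. 0 \<le> t \<and> t \<le> 1 \<longrightarrow>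
        F (\<lambda>x. (1 - t) * m x + t * m' x, \<lambda>e. (1 - t) * J e + t * J' e)
          \<le> ereal (1 - t) * F (m, J) + ereal t * F (m', J'))"

text \<open>Function spaces carry the product topology.\<close>

definition lsc_cost :: "('d::finite, 'v::finite) vertex rel \<Rightarrow> ('d, 'v) cost \<Rightarrow> bool" where
  "lsc_cost E F \<longleftrightarrow>
     (\<forall>u \<in> masses \<times> flows E. F u \<le> Liminf (at u within masses \<times> flows E) F)"

definition window :: "real \<Rightarrow> ('d::finite, 'v::finite) vertex set" where
  "window r = {x. linf (fst x) \<le> r}"

definition local_cost :: "('d::finite, 'v::finite) vertex rel \<Rightarrow> real \<Rightarrow> ('d, 'v) cost \<Rightarrow> bool" where
  "local_cost E R1 F \<longleftrightarrow>
     (\<forall>m\<in>masses. \<forall>m'\<in>masses. \<forall>J\<in>flows E. \<forall>J'\<in>flows E.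
        (\<forall>x\<in>window R1. m x = m' x) \<and>
        (\<forall>(x, y)\<in>E. x \<in> window R1 \<and> y \<in> window R1 \<longrightarrow> J (x, y) = J' (x, y)) \<longrightarrow>
        F (m, J) = F (m', J'))"

definition growth_cost :: "('d::finite, 'v::finite) vertex rel \<Rightarrow> real \<Rightarrow> ('d, 'v) cost \<Rightarrow> bool" where
  "growth_cost E R1 F \<longleftrightarrow>
     (\<exists>c C :: real. 0 < c \<and>
        (\<forall>m\<in>masses. \<forall>J\<in>flows E.
           ereal (c * (\<Sum>e\<in>cell_edges E. \<bar>J e\<bar>)
             - C * (1 + (\<Sum>x\<in>window (max (edge_range E) R1). m x))) \<le> F (m, J)))"

definition cost_domain :: "('d::finite, 'v::finite) vertex rel \<Rightarrow> ('d, 'v) cost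
    \<Rightarrow> ((('d, 'v) vertex \<Rightarrow> real) \<times> (('d, 'v) vertex \<times> ('d, 'v) vertex \<Rightarrow> real)) set" where
  "cost_domain E F = {(m, J). m \<in> masses \<and> J \<in> flows E \<and> F (m, J) < \<infinity>}"

text \<open>The parameters \<^term>\<open>m x\<close> and \<^term>\<open>J (x, y)\<close> with \<^term>\<open>x\<close> and \<^term>\<open>y\<close> in the window of
  radius \<^term>\<open>r\<close> range over the finite-dimensional space \<open>param_space E r\<close>. Its first component
  consists of real-valued, not just nonnegative, functions, so interior points of the domain of a
  cost have positive mass in the window.\<close>

definition restrict_params :: "real
    \<Rightarrow> (('d::finite, 'v::finite) vertex \<Rightarrow> real) \<times> (('d, 'v) vertex \<times> ('d, 'v) vertex \<Rightarrow> real)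
    \<Rightarrow> (('d, 'v) vertex \<Rightarrow> real) \<times> (('d, 'v) vertex \<times> ('d, 'v) vertex \<Rightarrow> real)" where
  "restrict_params r = (\<lambda>(m, J).
     (\<lambda>x. if x \<in> window r then m x else 0,
      \<lambda>(x, y). if x \<in> window r \<and> y \<in> window r then J (x, y) else 0))"

definition param_space :: "('d::finite, 'v::finite) vertex rel \<Rightarrow> real
    \<Rightarrow> ((('d, 'v) vertex \<Rightarrow> real) \<times> (('d, 'v) vertex \<times> ('d, 'v) vertex \<Rightarrow> real)) set" where
  "param_space E r = restrict_params r ` (UNIV \<times> flows E)"

definition interior_cost :: "('d::finite, 'v::finite) vertex rel \<Rightarrow> real \<Rightarrow> ('d, 'v) cost \<Rightarrow> bool" where
  "interior_cost E R1 F \<longleftrightarrow>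
     (\<exists>m\<in>masses. \<exists>J\<in>flows E.
        periodic_mass m \<and> periodic_flow J \<and> (\<forall>x. divergence E J x = 0) \<and>
        restrict_params R1 (m, J) \<in>
          top_of_set (param_space E R1) interior_of (restrict_params R1 ` cost_domain E F))"

definition admissible_cost :: "('d::finite, 'v::finite) vertex rel \<Rightarrow> ('d, 'v) cost \<Rightarrow> bool" where
  "admissible_cost E F \<longleftrightarrow>
     (\<forall>m\<in>masses. \<forall>J\<in>flows E. F (m, J) \<noteq> -\<infinity>) \<and>
     convex_cost E F \<and> lsc_cost E F \<and>
     (\<exists>R1. local_cost E R1 F \<and> growth_cost E R1 F \<and> interior_cost E R1 F)"

definition Rep :: "('d::finite, 'v::finite) vertex rel \<Rightarrow> real \<Rightarrow> real ^ 'd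
    \<Rightarrow> ((('d, 'v) vertex \<Rightarrow> real) \<times> (('d, 'v) vertex \<times> ('d, 'v) vertex \<Rightarrow> real)) set" where
  "Rep E \<rho> j = {(m, J). m \<in> masses \<and> J \<in> flows E \<and> periodic_mass m \<and> periodic_flow J \<and>
     (\<Sum>x\<in>cell_vertices. m x) = \<rho> \<and>
     (\<forall>x. divergence E J x = 0) \<and>
     (1 / 2) *\<^sub>R (\<Sum>(x, y)\<in>cell_edges E. J (x, y) *\<^sub>R real_vec (fst y - fst x)) = j}"

definition f_hom :: "('d::finite, 'v::finite) vertex rel \<Rightarrow> ('d, 'v) cost \<Rightarrow> real \<Rightarrow> real ^ 'd \<Rightarrow> ereal" where
  "f_hom E F \<rho> j = (INF u\<in>Rep E \<rho> j. F u)"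

definition is_norm :: "('a::real_vector \<Rightarrow> real) \<Rightarrow> bool" where
  "is_norm N \<longleftrightarrow>
     (\<forall>x. 0 \<le> N x) \<and> (\<forall>x. N x = 0 \<longleftrightarrow> x = 0) \<and>
     (\<forall>a x. N (a *\<^sub>R x) = \<bar>a\<bar> * N x) \<and> (\<forall>x y. N (x + y) \<le> N x + N y)"

end

theory Submission
  imports Defs
begin

text \<open>
  Write \<open>f = f_hom\<close>. The two homogeneity assumptions pass to \<open>f\<close> and leave only the one function
  \<open>f(1, \<cdot>)\<close> free: scaling mass by \<open>a > 0\<close> and flow by \<open>b\<close> multiplies \<open>F\<close>, hence also \<open>f\<close>, by
  \<open>a \<bar>b / a\<bar>\<^sup>p\<close>. So \<open>f(\<rho>, j) = \<rho>\<^sup>1\<^sup>-\<^sup>p f(1, j)\<close>, the norm must be \<open>N j = f(1, j)\<^sup>1\<^sup>/\<^sup>p\<close>, and the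
  homogeneity of \<open>N\<close> is immediate. Four points remain.

  Nonnegativity: a flow \<open>J\<close> and its reverse \<open>-J\<close> have the same cost and average to the zero flow,
  whose cost is zero, so convexity gives \<open>F \<ge> 0\<close>.

  Finiteness: every \<open>j\<close> is the flux of some periodic divergence-free flow. Indeed a path in the graph
  from \<open>x\<close> to a translate \<open>x + z\<close>, summed over all its translates, is such a flow with flux \<open>z\<close>; and
  the fluxes form a linear space. A small multiple of such a flow may be added to the
  interior point of the domain without leaving the domain; symmetrising under reversal removes the
  flow of the interior point, and subadditivity allows mass to be added.

  Definiteness: the growth bound makes \<open>f(1, j)\<close> at least linear in \<open>j\<close> up to a constant, so \<open>f(1, \<cdot>)\<close>
  cannot vanish on a whole line.

  Triangle inequality: convexity and 1-homogeneity make \<open>F\<close>, hence \<open>f\<close>, jointly subadditive. Unit mass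
  is split between \<open>j\<close> and \<open>j'\<close> in proportion \<open>N j : N j'\<close>; then with \<open>s = N j + N j'\<close> the two parts
  cost \<open>N j * s\<^sup>p\<^sup>-\<^sup>1\<close> and \<open>N j' * s\<^sup>p\<^sup>-\<^sup>1\<close>, in total \<open>s\<^sup>p\<close>.
\<close>

section \<open>Periodic flows and their flux\<close>

definition flux :: "('d::finite, 'v::finite) vertex rel
    \<Rightarrow> (('d, 'v) vertex \<times> ('d, 'v) vertex \<Rightarrow> real) \<Rightarrow> real ^ 'd" where
  "flux E J = (1 / 2) *\<^sub>R (\<Sum>(x, y)\<in>cell_edges E. J (x, y) *\<^sub>R real_vec (fst y - fst x))"

definition circulations :: "('d::finite, 'v::finite) vertex rel
    \<Rightarrow> (('d, 'v) vertex \<times> ('d, 'v) vertex \<Rightarrow> real) set" where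
  "circulations E = {J \<in> flows E. periodic_flow J \<and> (\<forall>x. divergence E J x = 0)}"

lemma Rep_iff:
  "(m, J) \<in> Rep E \<rho> j \<longleftrightarrow>
     m \<in> masses \<and> periodic_mass m \<and> (\<Sum>x\<in>cell_vertices. m x) = \<rho> \<and>
     J \<in> circulations E \<and> flux E J = j"
  by (auto simp: Rep_def circulations_def flux_def)

lemma real_vec_diff: "real_vec (x - y) = real_vec x - real_vec y"
  by (simp add: real_vec_def vec_eq_iff)

text \<open>Antisymmetry in the form of a vanishing sum: the equation in the definition would loop as a
  rewrite rule.\<close>

lemma flows_iff:
  "J \<in> flows E \<longleftrightarrow> (\<forall>e. e \<notin> E \<longrightarrow> J e = 0) \<and> (\<forall>x y. J (x, y) + J (y, x) = 0)"
  unfolding flows_def by (simp add: eq_neg_iff_add_eq_0 add.commute)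

lemma flows_lincomb:
  assumes "J \<in> flows E" "J' \<in> flows E"
  shows "(\<lambda>e. a * J e + b * J' e) \<in> flows E"
proof -
  have "a * J (x, y) + b * J' (x, y) + (a * J (y, x) + b * J' (y, x)) = 0" for x y
  proof -
    have "J (x, y) + J (y, x) = 0" "J' (x, y) + J' (y, x) = 0"
      using assms unfolding flows_iff by blast+
    then show ?thesis
      by algebra
  qed
  then show ?thesis
    using assms by (simp add: flows_iff)
qed

lemma divergence_lincomb:
  "divergence E (\<lambda>e. a * J e + b * J' e) x = a * divergence E J x + b * divergence E J' x"
  by (simp add: divergence_def sum.distrib sum_distrib_left)

lemma flux_lincomb: "flux E (\<lambda>e. a * J e + b * J' e) = a *\<^sub>R flux E J + b *\<^sub>R flux E J'"
  by (simp add: flux_def case_prod_beta scaleR_add_left scaleR_add_right sum.distrib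
      scaleR_sum_right mult.left_commute)

lemma circulations_lincomb:
  assumes "J \<in> circulations E" "J' \<in> circulations E"
  shows "(\<lambda>e. a * J e + b * J' e) \<in> circulations E"
  using assms flows_lincomb[of J E J' a b]
  by (simp add: circulations_def divergence_lincomb periodic_flow_def)

lemma circulations_scale:
  assumes "J \<in> circulations E"
  shows "(\<lambda>e. a * J e) \<in> circulations E"
  using circulations_lincomb[OF assms assms, of a 0] by simp

lemma flux_scale: "flux E (\<lambda>e. a * J e) = a *\<^sub>R flux E J"
  using flux_lincomb[of E a J 0 J] by simp

lemma zero_circulation: "(\<lambda>_. 0) \<in> circulations E"
  by (simp add: circulations_def flows_def periodic_flow_def divergence_def)

lemma flows_scale:
  assumes "J \<in> flows E"
  shows "(\<lambda>e. a * J e) \<in> flows E"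
  using flows_lincomb[OF assms assms, of a 0] by simp

lemma
  assumes "periodic_graph E"
  shows periodic_graph_sym: "(x, y) \<in> E \<Longrightarrow> (y, x) \<in> E"
    and periodic_graph_shift: "(x, y) \<in> E \<Longrightarrow> (shift z x, shift z y) \<in> E"
    and periodic_graph_connected: "(a, b) \<in> E\<^sup>*"
    and periodic_graph_finite: "finite {y. (a, y) \<in> E}"
  using assms unfolding periodic_graph_def sym_def by blast+

lemma finite_cell_vertices: "finite (cell_vertices :: ('d::finite, 'v::finite) vertex set)"
proof (rule finite_subset)
  show "cell_vertices \<subseteq> Pair (0 :: int ^ 'd) ` (UNIV :: 'v set)"
    by (auto simp: cell_vertices_def)
qed simp

lemma finite_cell_edges:
  fixes E :: "('d::finite, 'v::finite) vertex rel"
  assumes "periodic_graph E"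
  shows "finite (cell_edges E)"
proof (rule finite_subset)
  show "cell_edges E \<subseteq> (SIGMA x:cell_vertices. {y. (x, y) \<in> E})"
    by (auto simp: cell_edges_def cell_vertices_def)
  show "finite (SIGMA x:cell_vertices. {y. (x, y) \<in> E})"
    by (intro finite_SigmaI finite_cell_vertices periodic_graph_finite[OF assms])
qed

section \<open>Every vector is the flux of a periodic circulation\<close>

definition translate_of :: "('d::finite, 'v::finite) vertex \<times> ('d, 'v) vertex
    \<Rightarrow> ('d, 'v) vertex \<times> ('d, 'v) vertex \<Rightarrow> bool" where
  "translate_of e e' \<longleftrightarrow> snd (fst e') = snd (fst e) \<and> snd (snd e') = snd (snd e) \<and>
     fst (snd e') - fst (fst e') = fst (snd e) - fst (fst e)"

lemma translate_of_iff_from: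
  "translate_of (x, y) (a, b) \<longleftrightarrow> snd a = snd x \<and> b = (fst a + (fst y - fst x), snd y)"
  by (auto simp: translate_of_def prod_eq_iff algebra_simps)

lemma translate_of_swap: "translate_of (x, y) (a, b) \<longleftrightarrow> translate_of (y, x) (b, a)"
  by (auto simp: translate_of_def algebra_simps)

lemma translate_of_edge:
  assumes "periodic_graph E" "(x, y) \<in> E" "translate_of (x, y) (a, b)"
  shows "(a, b) \<in> E"
proof -
  have "(shift (fst a - fst x) x, shift (fst a - fst x) y) \<in> E"
    by (rule periodic_graph_shift[OF assms(1,2)])
  moreover have "shift (fst a - fst x) x = a" "shift (fst a - fst x) y = b"
    using assms(3) by (auto simp: shift_def translate_of_iff_from prod_eq_iff algebra_simps)
  ultimately show ?thesis by simp
qed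

text \<open>An edge leaves each vertex of the orbit of its source in exactly one translate; this makes
  both sums below consist of at most one nonzero term.\<close>

lemma sum_translates_from:
  fixes E :: "('d::finite, 'v::finite) vertex rel"
  assumes "periodic_graph E" "(x, y) \<in> E"
  shows "(\<Sum>b | (a, b) \<in> E. of_bool (translate_of (x, y) (a, b)))
    = (of_bool (snd a = snd x) :: real)"
proof -
  let ?b = "(fst a + (fst y - fst x), snd y)"
  have fin: "finite {b. (a, b) \<in> E}"
    by (rule periodic_graph_finite[OF assms(1)])
  have "?b \<in> {b. (a, b) \<in> E}" if "snd a = snd x"
    using translate_of_edge[OF assms, of a ?b] that by (simp add: translate_of_iff_from)
  moreover have "(\<Sum>b | (a, b) \<in> E. of_bool (translate_of (x, y) (a, b)))
    = (\<Sum>b | (a, b) \<in> E. if b = ?b then of_bool (snd a = snd x) else (0::real))"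
    by (intro sum.cong) (auto simp: translate_of_iff_from)
  ultimately show ?thesis
    using fin by (cases "snd a = snd x") (simp_all add: sum.delta del: sum_of_bool_eq)
qed

lemma sum_translates_cell:
  fixes E :: "('d::finite, 'v::finite) vertex rel"
  assumes "periodic_graph E" "(x, y) \<in> E"
  shows "(\<Sum>(a, b)\<in>cell_edges E. of_bool (translate_of (x, y) (a, b)) *\<^sub>R real_vec (fst b - fst a))
    = real_vec (fst y - fst x)"
proof -
  let ?e = "((0, snd x), (fst y - fst x, snd y)) :: ('d, 'v) vertex \<times> ('d, 'v) vertex"
  have "?e \<in> cell_edges E"
    using translate_of_edge[OF assms, of "fst ?e" "snd ?e"]
    by (simp add: cell_edges_def translate_of_iff_from)
  moreover have "(\<Sum>(a, b)\<in>cell_edges E. of_bool (translate_of (x, y) (a, b)) *\<^sub>R real_vec (fst b - fst a))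
    = (\<Sum>e\<in>cell_edges E. if e = ?e then real_vec (fst y - fst x) else 0)"
    by (intro sum.cong) (auto simp: translate_of_iff_from cell_edges_def prod_eq_iff)
  ultimately show ?thesis
    using finite_cell_edges[OF assms(1)] by (simp add: sum.delta)
qed

text \<open>The unit flow through all translates of one edge. The two summands cancel when the edge is a
  loop, and otherwise have disjoint supports.\<close>

lemma edge_flow:
  assumes G: "periodic_graph E" and xy: "(x, y) \<in> E"
  shows "\<exists>J \<in> flows E. periodic_flow J \<and>
    (\<forall>a. divergence E J a = of_bool (snd a = snd x) - of_bool (snd a = snd y)) \<and>
    flux E J = real_vec (fst y - fst x)"
proof -
  define J where "J = (\<lambda>e. of_bool (translate_of (x, y) e) - of_bool (translate_of (y, x) e) :: real)"
  have yx: "(y, x) \<in> E"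
    by (rule periodic_graph_sym[OF G xy])
  have "J \<in> flows E"
    using translate_of_edge[OF G xy] translate_of_edge[OF G yx]
    by (auto simp: J_def flows_def translate_of_swap[of x y])
  moreover have "periodic_flow J"
    by (simp add: J_def periodic_flow_def translate_of_def shift_def)
  moreover have "divergence E J a = of_bool (snd a = snd x) - of_bool (snd a = snd y)" for a
    using sum_translates_from[OF G xy, of a] sum_translates_from[OF G yx, of a]
    by (simp add: J_def divergence_def sum_subtractf)
  moreover have "flux E J = real_vec (fst y - fst x)"
  proof -
    have "flux E J = (1 / 2) *\<^sub>R (real_vec (fst y - fst x) - real_vec (fst x - fst y))"
      using sum_translates_cell[OF G xy] sum_translates_cell[OF G yx]
      by (simp add: J_def flux_def case_prod_beta scaleR_diff_left sum_subtractf)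
    also have "\<dots> = real_vec (fst y - fst x)"
      by (simp add: real_vec_diff flip: scaleR_2)
        (simp add: vec_eq_iff)
    finally show ?thesis .
  qed
  ultimately show ?thesis by blast
qed

text \<open>Adding up the edges of a path, the divergences telescope to the two endpoints and the fluxes to
  the total displacement.\<close>

lemma path_flow:
  assumes G: "periodic_graph E" and "(x, y) \<in> E\<^sup>*"
  shows "\<exists>J \<in> flows E. periodic_flow J \<and>
    (\<forall>a. divergence E J a = of_bool (snd a = snd x) - of_bool (snd a = snd y)) \<and>
    flux E J = real_vec (fst y - fst x)"
  using assms(2)
proof (induction rule: rtrancl_induct)
  case base
  have "flux E (\<lambda>_. 0) = real_vec (fst x - fst x)"
    by (simp add: flux_def real_vec_def vec_eq_iff)
  with zero_circulation[of E] show ?case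
    by (intro bexI[of _ "\<lambda>_. 0"]) (auto simp: circulations_def)
next
  case (step y z)
  then obtain J where J: "J \<in> flows E" "periodic_flow J"
    "\<And>a. divergence E J a = of_bool (snd a = snd x) - of_bool (snd a = snd y)"
    "flux E J = real_vec (fst y - fst x)"
    by blast
  obtain K where K: "K \<in> flows E" "periodic_flow K"
    "\<And>a. divergence E K a = of_bool (snd a = snd y) - of_bool (snd a = snd z)"
    "flux E K = real_vec (fst z - fst y)"
    using edge_flow[OF G step(2)] by blast
  show ?case
  proof (intro bexI conjI allI)
    show "(\<lambda>e. 1 * J e + 1 * K e) \<in> flows E"
      by (rule flows_lincomb[OF J(1) K(1)])
    show "periodic_flow (\<lambda>e. 1 * J e + 1 * K e)"
      using J(2) K(2) by (simp add: periodic_flow_def)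
    show "divergence E (\<lambda>e. 1 * J e + 1 * K e) a = of_bool (snd a = snd x) - of_bool (snd a = snd z)"
      for a
      by (simp only: divergence_lincomb J(3) K(3)) simp
    show "flux E (\<lambda>e. 1 * J e + 1 * K e) = real_vec (fst z - fst x)"
      by (simp only: flux_lincomb J(4) K(4)) (simp add: real_vec_diff)
  qed
qed

lemma circulation_with_flux:
  fixes E :: "('d::finite, 'v::finite) vertex rel" and j :: "real ^ 'd"
  assumes G: "periodic_graph E"
  shows "\<exists>J \<in> circulations E. flux E J = j"
proof -
  let ?S = "flux E ` circulations E"
  have "subspace ?S"
    unfolding subspace_def
  proof (intro conjI ballI allI)
    show "0 \<in> ?S"
      using flux_scale[of E 0 "\<lambda>_. 0"] zero_circulation[of E] by (auto intro!: image_eqI)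
    show "a + b \<in> ?S" if "a \<in> ?S" "b \<in> ?S" for a b
    proof -
      from that obtain J K where JK: "J \<in> circulations E" "K \<in> circulations E"
        "a = flux E J" "b = flux E K"
        by blast
      show ?thesis
        using JK flux_lincomb[of E 1 J 1 K] circulations_lincomb[of J E K 1 1]
        by (intro image_eqI[of _ _ "\<lambda>e. 1 * J e + 1 * K e"]) simp_all
    qed
    show "c *\<^sub>R a \<in> ?S" if "a \<in> ?S" for c a
    proof -
      from that obtain J where "J \<in> circulations E" "a = flux E J"
        by blast
      then show ?thesis
        by (intro image_eqI[of _ _ "\<lambda>e. c * J e"]) (simp_all add: flux_scale circulations_scale)
    qed
  qed
  moreover have "Basis \<subseteq> ?S"
  proof
    fix b :: "real ^ 'd" assume "b \<in> Basis"
    then obtain i where b: "b = axis i 1"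
      by (auto simp: Basis_vec_def)
    \<comment> \<open>Both endpoints lie in the same orbit, so the path flow between them is divergence-free.\<close>
    let ?x = "(0, undefined) :: ('d, 'v) vertex" and ?y = "(axis i 1, undefined) :: ('d, 'v) vertex"
    have "(?x, ?y) \<in> E\<^sup>*"
      by (rule periodic_graph_connected[OF G])
    from path_flow[OF G this] obtain J where J: "J \<in> flows E" "periodic_flow J"
      "\<forall>a. divergence E J a = 0" "flux E J = real_vec (axis i 1)"
      by auto
    moreover have "real_vec (axis i 1) = b"
      by (auto simp: real_vec_def b vec_eq_iff axis_def)
    ultimately show "b \<in> ?S"
      by (auto simp: circulations_def)
  qed
  ultimately have "span Basis \<subseteq> ?S"
    by (rule span_minimal[rotated])
  then have "j \<in> ?S"
    by auto
  then show ?thesis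
    by blast
qed

section \<open>Homogeneous convex costs\<close>

lemma local_costD:
  assumes "local_cost E R F"
    and "m \<in> masses" "m' \<in> masses" "J \<in> flows E" "J' \<in> flows E"
    and "\<And>x. x \<in> window R \<Longrightarrow> m x = m' x"
    and "\<And>x y. x \<in> window R \<Longrightarrow> y \<in> window R \<Longrightarrow> J (x, y) = J' (x, y)"
  shows "F (m, J) = F (m', J')"
  by (rule assms(1)[unfolded local_cost_def, THEN bspec, OF assms(2), THEN bspec, OF assms(3),
        THEN bspec, OF assms(4), THEN bspec, OF assms(5), THEN mp])
    (use assms(6,7) in blast)

locale homogeneous_cost =
  fixes E :: "('d::finite, 'v::finite) vertex rel"
    and F :: "('d, 'v) cost"
    and p :: real
  assumes graph: "periodic_graph E"
    and admissible: "admissible_cost E F"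
    and p_ge_1: "1 \<le> p"
    and scale_both: "\<And>m J l. m \<in> masses \<Longrightarrow> J \<in> flows E \<Longrightarrow> 0 \<le> l \<Longrightarrow>
           F (\<lambda>x. l * m x, \<lambda>e. l * J e) = ereal l * F (m, J)"
    and scale_flow: "\<And>m J l. m \<in> masses \<Longrightarrow> J \<in> flows E \<Longrightarrow>
           F (m, \<lambda>e. l * J e) = ereal (\<bar>l\<bar> powr p) * F (m, J)"
begin

lemma convex:
  assumes "m \<in> masses" "m' \<in> masses" "J \<in> flows E" "J' \<in> flows E" "0 \<le> t" "t \<le> 1"
  shows "F (\<lambda>x. (1 - t) * m x + t * m' x, \<lambda>e. (1 - t) * J e + t * J' e)
          \<le> ereal (1 - t) * F (m, J) + ereal t * F (m', J')"
  using admissible assms unfolding admissible_cost_def convex_cost_def by blast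

lemma cost_zero_flow:
  assumes "m \<in> masses"
  shows "F (m, \<lambda>_. 0) = 0"
proof -
  have "(\<lambda>_. 0) \<in> flows E"
    by (simp add: flows_def)
  from scale_flow[OF assms this, of 0] show ?thesis
    by (simp add: zero_ereal_def[symmetric])
qed

lemma cost_uminus:
  assumes "m \<in> masses" "J \<in> flows E"
  shows "F (m, \<lambda>e. - J e) = F (m, J)"
  using scale_flow[OF assms, of "-1"] by (simp add: one_ereal_def[symmetric])

text \<open>The two scalings combined: \<open>(a m, b J) = a (m, (b / a) J)\<close>.\<close>

lemma cost_scale:
  assumes "m \<in> masses" "J \<in> flows E" "0 < a"
  shows "F (\<lambda>x. a * m x, \<lambda>e. b * J e) = ereal (a * \<bar>b / a\<bar> powr p) * F (m, J)"
proof -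
  have "F (\<lambda>x. a * m x, \<lambda>e. a * (b / a * J e)) = ereal a * F (m, \<lambda>e. b / a * J e)"
    using assms by (intro scale_both flows_scale) auto
  then show ?thesis
    using assms by (simp add: scale_flow[OF assms(1,2), of "b / a", simplified] mult.assoc[symmetric])
qed

text \<open>Degree-one homogeneity turns convexity, applied to the doubled arguments, into subadditivity.\<close>

lemma cost_add_le:
  assumes "m \<in> masses" "m' \<in> masses" "J \<in> flows E" "J' \<in> flows E"
  shows "F (\<lambda>x. m x + m' x, \<lambda>e. J e + J' e) \<le> F (m, J) + F (m', J')"
proof -
  have "(\<lambda>x. 2 * m x) \<in> masses" "(\<lambda>x. 2 * m' x) \<in> masses"
    using assms by (auto simp: masses_def)
  from convex[OF this flows_scale[OF assms(3), of 2] flows_scale[OF assms(4), of 2], of "1/2"]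
  have "F (\<lambda>x. m x + m' x, \<lambda>e. J e + J' e)
    \<le> ereal (1/2) * F (\<lambda>x. 2 * m x, \<lambda>e. 2 * J e) + ereal (1/2) * F (\<lambda>x. 2 * m' x, \<lambda>e. 2 * J' e)"
    by simp
  also have "\<dots> = F (m, J) + F (m', J')"
    using scale_both[of m J 2] scale_both[of m' J' 2] assms
    by (simp add: mult.assoc[symmetric] one_ereal_def[symmetric])
  finally show ?thesis .
qed

lemma cost_nonneg:
  assumes "m \<in> masses" "J \<in> flows E"
  shows "0 \<le> F (m, J)"
proof -
  have "(\<lambda>e. - J e) \<in> flows E"
    using flows_scale[OF assms(2), of "-1"] by simp
  \<comment> \<open>Opposite flows cancel in the sum, whose cost is therefore zero.\<close>
  from cost_add_le[OF assms(1,1,2) this]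
  have "0 \<le> F (m, J) + F (m, J)"
    using assms cost_zero_flow[of "\<lambda>x. m x + m x"] cost_uminus[OF assms]
    by (simp add: masses_def)
  then show ?thesis
    by (cases "F (m, J)") auto
qed

section \<open>Finiteness and coercivity\<close>

text \<open>An interior point of the domain can be moved a little in any direction \<open>K\<close>: locality makes the
  cost depend on the restriction to the window alone.\<close>

lemma domain_interior_perturb:
  "\<exists>m \<in> masses. periodic_mass m \<and> (\<exists>J \<in> flows E. \<forall>K \<in> flows E.
     \<exists>t > 0. F (m, \<lambda>e. J e + t * K e) < \<infinity> \<and> F (m, \<lambda>e. J e - t * K e) < \<infinity>)"
proof -
  obtain R m J where loc: "local_cost E R F" and m: "m \<in> masses" "periodic_mass m"
    and J: "J \<in> flows E"
    and int: "restrict_params R (m, J) \<in>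
          top_of_set (param_space E R) interior_of (restrict_params R ` cost_domain E F)"
    using admissible unfolding admissible_cost_def interior_cost_def by blast
  from int obtain U where U: "open U" "restrict_params R (m, J) \<in> U"
    "param_space E R \<inter> U \<subseteq> restrict_params R ` cost_domain E F"
    unfolding interior_of_def by (auto simp: openin_open)
  have "\<exists>t > 0. F (m, \<lambda>e. J e + t * K e) < \<infinity> \<and> F (m, \<lambda>e. J e - t * K e) < \<infinity>"
    if K: "K \<in> flows E" for K
  proof -
    define G where "G = (\<lambda>t::real. restrict_params R (m, \<lambda>e. J e + t * K e))"
    have flow: "(\<lambda>e. J e + t * K e) \<in> flows E" for t
      using flows_lincomb[OF J K, of 1 t] by simp
    have fin: "F (m, \<lambda>e. J e + t * K e) < \<infinity>" if "G t \<in> U" for t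
    proof -
      have "G t \<in> param_space E R"
        using flow by (auto simp: G_def param_space_def)
      with U(3) that have "G t \<in> restrict_params R ` cost_domain E F"
        by blast
      then obtain m' J' where m'J': "(m', J') \<in> cost_domain E F"
        "G t = restrict_params R (m', J')"
        by (metis imageE surj_pair)
      have "F (m, \<lambda>e. J e + t * K e) = F (m', J')"
      proof -
        have eq1: "(if x \<in> window R then m x else 0) = (if x \<in> window R then m' x else 0)" for x
          using arg_cong[OF m'J'(2), of "\<lambda>u. fst u x"] by (simp add: G_def restrict_params_def)
        have eq2: "(if x \<in> window R \<and> y \<in> window R then J (x, y) + t * K (x, y) else 0)
            = (if x \<in> window R \<and> y \<in> window R then J' (x, y) else 0)" for x y
          using arg_cong[OF m'J'(2), of "\<lambda>u. snd u (x, y)"] by (simp add: G_def restrict_params_def)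
        have "m' \<in> masses" "J' \<in> flows E"
          using m'J'(1) by (auto simp: cost_domain_def)
        moreover have "m x = m' x" if "x \<in> window R" for x
          using eq1[of x] that by simp
        moreover have "J (x, y) + t * K (x, y) = J' (x, y)" if "x \<in> window R" "y \<in> window R" for x y
          using eq2[of x y] that by simp
        ultimately show ?thesis
          using m(1) flow[of t] by (intro local_costD[OF loc]) assumption+
      qed
      then show ?thesis
        using m'J'(1) by (simp add: cost_domain_def)
    qed
    have "continuous_on UNIV (\<lambda>t. snd (G t) e)" for e
      by (cases "fst e \<in> window R \<and> snd e \<in> window R")
        (auto simp: G_def restrict_params_def case_prod_beta intro!: continuous_intros)
    then have "continuous_on UNIV (\<lambda>t. (fst (G 0), snd (G t)))"
      by (intro continuous_on_Pair continuous_on_const continuous_on_coordinatewise_then_product)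
    also have "(\<lambda>t. (fst (G 0), snd (G t))) = G"
      by (simp add: G_def restrict_params_def)
    finally have "continuous_on UNIV G" .
    then have "open (G -` U)"
      using U(1) by (simp add: open_vimage)
    moreover have "0 \<in> G -` U"
      using U(2) by (simp add: G_def)
    ultimately obtain r where r: "r > 0" "ball 0 r \<subseteq> G -` U"
      by (meson openE)
    from r(1) have "r / 2 \<in> ball 0 r" "- (r / 2) \<in> ball 0 r"
      by simp_all
    with r(2) have "r / 2 \<in> G -` U" "- (r / 2) \<in> G -` U"
      by blast+
    with fin[of "r / 2"] fin[of "- (r / 2)"] r(1) show ?thesis
      by (intro exI[of _ "r / 2"]) simp
  qed
  with m J show ?thesis by blast
qed

text \<open>If \<open>J\<^sub>0\<close> is the flow of the interior point and \<open>t\<close> is small, then \<open>J\<^sub>0 + t K\<close> and, by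
  reversal, \<open>-J\<^sub>0 + t K\<close> have finite cost; their sum is a multiple of \<open>K\<close>.\<close>

lemma finite_cost_mass:
  "\<exists>m \<in> masses. periodic_mass m \<and> 0 < (\<Sum>x\<in>cell_vertices. m x) \<and> (\<forall>K \<in> flows E. F (m, K) < \<infinity>)"
proof -
  obtain m J where m: "m \<in> masses" "periodic_mass m" and J: "J \<in> flows E"
    and fin: "\<And>K. K \<in> flows E \<Longrightarrow>
      \<exists>t > 0. F (m, \<lambda>e. J e + t * K e) < \<infinity> \<and> F (m, \<lambda>e. J e - t * K e) < \<infinity>"
    using domain_interior_perturb by blast
  \<comment> \<open>The constant mass one, added at no cost, makes the total mass positive.\<close>
  define n where "n = (\<lambda>x. 2 * m x + 1)"
  have n: "n \<in> masses" "periodic_mass n"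
    using m by (auto simp: n_def masses_def periodic_mass_def)
  have "0 < (\<Sum>x\<in>cell_vertices. n x)"
  proof (rule sum_pos)
    show "finite (cell_vertices :: ('d, 'v) vertex set)"
      by (rule finite_cell_vertices)
    show "(cell_vertices :: ('d, 'v) vertex set) \<noteq> {}"
      by (auto simp: cell_vertices_def)
    show "0 < n x" for x
      using m(1) unfolding n_def masses_def mem_Collect_eq
      by (intro add_nonneg_pos) (simp_all del: split_paired_All)
  qed
  moreover have "F (n, K) < \<infinity>" if K: "K \<in> flows E" for K
  proof -
    obtain t where t: "t > 0" "F (m, \<lambda>e. J e + t * K e) < \<infinity>" "F (m, \<lambda>e. J e - t * K e) < \<infinity>"
      using fin[OF K] by blast
    have flow: "(\<lambda>e. a * J e + b * K e) \<in> flows E" for a b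
      by (rule flows_lincomb[OF J K])
    have one: "(\<lambda>_. 1) \<in> masses" and zero: "(\<lambda>_. 0) \<in> flows E" and mm: "(\<lambda>x. m x + m x) \<in> masses"
      using m(1) by (auto simp: masses_def flows_def)
    have "F (m, \<lambda>e. t * K e - J e) < \<infinity>"
      using cost_uminus[OF m(1) flow[of 1 "- t"]] t(3) by simp
    moreover have "F (\<lambda>x. m x + m x, \<lambda>e. (J e + t * K e) + (t * K e - J e))
        \<le> F (m, \<lambda>e. J e + t * K e) + F (m, \<lambda>e. t * K e - J e)"
      using cost_add_le[OF m(1) m(1) flow[of 1 t] flow[of "-1" t]] by simp
    ultimately have "F (\<lambda>x. m x + m x, \<lambda>e. 2 * t * K e) < \<infinity>"
      using t(2) by (auto simp: algebra_simps intro: le_less_trans)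
    moreover have "F (n, \<lambda>e. 2 * t * K e) \<le> F (\<lambda>x. m x + m x, \<lambda>e. 2 * t * K e) + F (\<lambda>_. 1, \<lambda>_. 0)"
      using cost_add_le[OF mm one flows_scale[OF K, of "2 * t"] zero] by (simp add: n_def)
    ultimately have "F (n, \<lambda>e. 2 * t * K e) < \<infinity>"
      using cost_zero_flow[OF one] by (auto intro: le_less_trans)
    then show ?thesis
      using scale_flow[OF n(1) K, of "2 * t"] t(1)
      by (cases "F (n, K)") auto
  qed
  ultimately show ?thesis
    using n by blast
qed

lemma f_hom_le: "(m, J) \<in> Rep E \<rho> j \<Longrightarrow> f_hom E F \<rho> j \<le> F (m, J)"
  unfolding f_hom_def by (rule INF_lower)

lemma Rep_flows: "(m, J) \<in> Rep E \<rho> j \<Longrightarrow> m \<in> masses \<and> J \<in> flows E"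
  by (simp add: Rep_def)

lemma f_hom_nonneg: "0 \<le> f_hom E F \<rho> j"
  unfolding f_hom_def by (intro INF_greatest) (auto dest: Rep_flows intro: cost_nonneg)

lemma Rep_scale:
  assumes "(m, J) \<in> Rep E \<rho> j" "0 \<le> a"
  shows "(\<lambda>x. a * m x, \<lambda>e. b * J e) \<in> Rep E (a * \<rho>) (b *\<^sub>R j)"
  using assms circulations_scale[of J E b] flux_scale[of E b J]
  by (auto simp: Rep_iff masses_def periodic_mass_def sum_distrib_left)

lemma Rep_add:
  assumes "(m, J) \<in> Rep E \<rho> j" "(m', J') \<in> Rep E \<rho>' j'"
  shows "(\<lambda>x. m x + m' x, \<lambda>e. J e + J' e) \<in> Rep E (\<rho> + \<rho>') (j + j')"
  using assms circulations_lincomb[of J E J' 1 1] flux_lincomb[of E 1 J 1 J']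
  by (auto simp: Rep_iff masses_def periodic_mass_def sum.distrib)

lemma f_hom_less_infinity:
  assumes "0 < \<rho>"
  shows "f_hom E F \<rho> j < \<infinity>"
proof -
  obtain m where m: "m \<in> masses" "periodic_mass m" "0 < (\<Sum>x\<in>cell_vertices. m x)"
    "\<And>K. K \<in> flows E \<Longrightarrow> F (m, K) < \<infinity>"
    using finite_cost_mass by blast
  define s where "s = (\<Sum>x\<in>cell_vertices. m x)"
  obtain J where J: "J \<in> circulations E" "flux E J = j"
    using circulation_with_flux[OF graph] by blast
  then have "J \<in> flows E"
    by (simp add: circulations_def)
  have "(m, J) \<in> Rep E s j"
    using m J by (simp add: Rep_iff s_def)
  from Rep_scale[OF this, of "\<rho> / s" 1]
  have "(\<lambda>x. \<rho> / s * m x, \<lambda>e. 1 * J e) \<in> Rep E \<rho> j"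
    using assms m(3) by (simp add: s_def)
  from f_hom_le[OF this]
  have "f_hom E F \<rho> j \<le> ereal (\<rho> / s * \<bar>1 / (\<rho> / s)\<bar> powr p) * F (m, J)"
    using cost_scale[OF m(1) \<open>J \<in> flows E\<close>, of "\<rho> / s" 1] assms m(3) by (simp add: s_def)
  also have "\<dots> < \<infinity>"
    using m(4)[OF \<open>J \<in> flows E\<close>] cost_nonneg[OF m(1) \<open>J \<in> flows E\<close>] by (cases "F (m, J)") auto
  finally show ?thesis .
qed

text \<open>At unit mass a periodic mass is bounded by one everywhere, so the mass term of the growth bound is
  at most a constant; the flow term controls the flux because edges have bounded length.\<close>

lemma f_hom_coercive:
  "\<exists>c C. 0 < c \<and> (\<forall>j. ereal (c * norm j - C) \<le> f_hom E F 1 j)"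
proof -
  obtain R c C where c: "0 < c"
    and gr: "\<And>m J. m \<in> masses \<Longrightarrow> J \<in> flows E \<Longrightarrow>
      ereal (c * (\<Sum>e\<in>cell_edges E. \<bar>J e\<bar>) - C * (1 + (\<Sum>x\<in>window (max (edge_range E) R). m x))) \<le> F (m, J)"
    using admissible unfolding admissible_cost_def growth_cost_def by blast
  define W :: "('d, 'v) vertex set" where "W = window (max (edge_range E) R)"
  define D where "D = 1 + (\<Sum>(x, y)\<in>cell_edges E. norm (real_vec (fst y - fst x)))"
  have D: "norm (real_vec (fst y - fst x)) \<le> D" if "(x, y) \<in> cell_edges E" for x y
    unfolding D_def
    using member_le_sum[OF that, of "\<lambda>(x, y). norm (real_vec (fst y - fst x))"]
      finite_cell_edges[OF graph] by (auto simp: case_prod_beta)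
  have D_pos: "0 < D"
    unfolding D_def by (intro add_pos_nonneg sum_nonneg) auto
  have "ereal (c / D * norm j - \<bar>C\<bar> * (1 + card W)) \<le> F (m, J)" if mJ: "(m, J) \<in> Rep E 1 j" for m J j
  proof -
    have m: "m \<in> masses" "periodic_mass m" "(\<Sum>x\<in>cell_vertices. m x) = 1" and "flux E J = j"
      using mJ by (auto simp: Rep_iff)
    \<comment> \<open>Every vertex is a translate of a cell vertex, whose mass is at most the total one.\<close>
    have "m x \<le> 1" for x
    proof -
      have "m x = m (0, snd x)"
        using m(2)[unfolded periodic_mass_def, rule_format, of "fst x" "(0, snd x)"]
        by (simp add: shift_def)
      also have "\<dots> \<le> (\<Sum>x\<in>cell_vertices. m x)"
        using m(1) by (intro member_le_sum finite_cell_vertices) (auto simp: cell_vertices_def masses_def)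
      finally show ?thesis using m(3) by simp
    qed
    then have "(\<Sum>x\<in>W. m x) \<le> card W"
      using sum_bounded_above[of W m 1] by simp
    moreover have "0 \<le> (\<Sum>x\<in>W. m x)"
      using m(1) by (intro sum_nonneg) (auto simp: masses_def)
    ultimately have mass: "C * (1 + (\<Sum>x\<in>W. m x)) \<le> \<bar>C\<bar> * (1 + card W)"
      by (intro mult_mono) auto
    have "norm j \<le> (\<Sum>(x, y)\<in>cell_edges E. norm (J (x, y) *\<^sub>R real_vec (fst y - fst x))) / 2"
      unfolding \<open>flux E J = j\<close>[symmetric] flux_def
      using norm_sum[of "\<lambda>(x, y). J (x, y) *\<^sub>R real_vec (fst y - fst x)" "cell_edges E"]
      by (simp add: case_prod_beta)
    also have "\<dots> \<le> (\<Sum>(x, y)\<in>cell_edges E. norm (J (x, y) *\<^sub>R real_vec (fst y - fst x)))"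
      by (simp add: sum_nonneg case_prod_beta)
    also have "\<dots> \<le> (\<Sum>e\<in>cell_edges E. \<bar>J e\<bar> * D)"
      using D by (intro sum_mono) (auto intro!: mult_left_mono)
    finally have "norm j \<le> D * (\<Sum>e\<in>cell_edges E. \<bar>J e\<bar>)"
      by (simp add: sum_distrib_left mult.commute)
    then have "c / D * norm j \<le> c * (\<Sum>e\<in>cell_edges E. \<bar>J e\<bar>)"
      using c D_pos by (simp add: field_simps)
    with mass have "ereal (c / D * norm j - \<bar>C\<bar> * (1 + card W))
      \<le> ereal (c * (\<Sum>e\<in>cell_edges E. \<bar>J e\<bar>) - C * (1 + (\<Sum>x\<in>W. m x)))"
      by simp
    also have "\<dots> \<le> F (m, J)"
      using gr[of m J] Rep_flows[OF mJ] by (simp add: W_def)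
    finally show ?thesis .
  qed
  then have "ereal (c / D * norm j - \<bar>C\<bar> * (1 + card W)) \<le> f_hom E F 1 j" for j
    unfolding f_hom_def by (intro INF_greatest) auto
  moreover have "0 < c / D"
    using c D_pos by simp
  ultimately show ?thesis by blast
qed

section \<open>The homogenised density\<close>

definition g :: "real \<Rightarrow> real ^ 'd \<Rightarrow> real" where
  "g \<rho> j = real_of_ereal (f_hom E F \<rho> j)"

lemma f_hom_eq: "0 < \<rho> \<Longrightarrow> f_hom E F \<rho> j = ereal (g \<rho> j)"
  using f_hom_nonneg[of \<rho> j] f_hom_less_infinity[of \<rho> j]
  by (cases "f_hom E F \<rho> j") (auto simp: g_def)

lemma g_nonneg: "0 \<le> g \<rho> j"
  using f_hom_nonneg[of \<rho> j] by (simp add: g_def real_of_ereal_pos)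

lemma near_optimal:
  assumes "0 < \<rho>" "0 < \<epsilon>"
  obtains m J r where "(m, J) \<in> Rep E \<rho> j" "F (m, J) = ereal r" "r < g \<rho> j + \<epsilon>"
proof -
  have "f_hom E F \<rho> j < ereal (g \<rho> j + \<epsilon>)"
    using assms by (simp add: f_hom_eq)
  then obtain m J where "(m, J) \<in> Rep E \<rho> j" "F (m, J) < ereal (g \<rho> j + \<epsilon>)"
    unfolding f_hom_def by (auto simp: INF_less_iff)
  moreover from this have "0 \<le> F (m, J)"
    using Rep_flows cost_nonneg by blast
  ultimately show ?thesis
    using that by (cases "F (m, J)") auto
qed

lemma g_add_le:
  assumes "0 < \<rho>" "0 < \<rho>'"
  shows "g (\<rho> + \<rho>') (j + j') \<le> g \<rho> j + g \<rho>' j'"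
proof (rule field_le_epsilon)
  fix e :: real assume "0 < e"
  then have e: "0 < e / 2" by simp
  obtain m J r where r: "(m, J) \<in> Rep E \<rho> j" "F (m, J) = ereal r" "r < g \<rho> j + e / 2"
    using near_optimal[OF assms(1) e] .
  obtain m' J' r' where r': "(m', J') \<in> Rep E \<rho>' j'" "F (m', J') = ereal r'" "r' < g \<rho>' j' + e / 2"
    using near_optimal[OF assms(2) e] .
  have "ereal (g (\<rho> + \<rho>') (j + j')) \<le> F (\<lambda>x. m x + m' x, \<lambda>e. J e + J' e)"
    using f_hom_le[OF Rep_add[OF r(1) r'(1)]] assms by (simp add: f_hom_eq)
  also have "\<dots> \<le> F (m, J) + F (m', J')"
    using Rep_flows[OF r(1)] Rep_flows[OF r'(1)] by (intro cost_add_le) auto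
  finally show "g (\<rho> + \<rho>') (j + j') \<le> g \<rho> j + g \<rho>' j' + e"
    using r r' by simp
qed

lemma g_scale_le:
  assumes "0 < \<rho>" "0 < a"
  shows "g (a * \<rho>) (b *\<^sub>R j) \<le> a * \<bar>b / a\<bar> powr p * g \<rho> j"
proof -
  let ?k = "a * \<bar>b / a\<bar> powr p"
  have k: "0 \<le> ?k" using assms by simp
  have "g (a * \<rho>) (b *\<^sub>R j) \<le> ?k * g \<rho> j + e" if "0 < e" for e
  proof -
    have e': "0 < e / (?k + 1)"
      using that k by (intro divide_pos_pos) auto
    obtain m J r where r: "(m, J) \<in> Rep E \<rho> j" "F (m, J) = ereal r" "r < g \<rho> j + e / (?k + 1)"
      using near_optimal[OF assms(1) e'] .
    have "ereal (g (a * \<rho>) (b *\<^sub>R j)) \<le> F (\<lambda>x. a * m x, \<lambda>e. b * J e)"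
      using f_hom_le[OF Rep_scale[OF r(1), of a b]] assms by (simp add: f_hom_eq)
    also have "\<dots> = ereal (?k * r)"
      using cost_scale[of m J a b] Rep_flows[OF r(1)] assms r(2) by simp
    finally have "g (a * \<rho>) (b *\<^sub>R j) \<le> ?k * r"
      by simp
    also have "\<dots> \<le> ?k * (g \<rho> j + e / (?k + 1))"
      using k r(3) by (intro mult_left_mono) auto
    also have "\<dots> \<le> ?k * g \<rho> j + e"
      using k that by (simp add: distrib_left field_simps)
    finally show ?thesis .
  qed
  then show ?thesis
    by (rule field_le_epsilon)
qed

text \<open>For \<open>b \<noteq> 0\<close> the scaling can be undone, which gives the reverse inequality; \<open>b = 0\<close> annihilates
  the flow and with it the cost.\<close>

lemma g_scale:
  assumes "0 < \<rho>" "0 < a"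
  shows "g (a * \<rho>) (b *\<^sub>R j) = a * \<bar>b / a\<bar> powr p * g \<rho> j"
proof (cases "b = 0")
  case True
  then show ?thesis
    using g_scale_le[OF assms, of b j] g_nonneg[of "a * \<rho>" "b *\<^sub>R j"] by simp
next
  case False
  have "g \<rho> j \<le> (1 / a) * \<bar>(1 / b) / (1 / a)\<bar> powr p * g (a * \<rho>) (b *\<^sub>R j)"
    using g_scale_le[of "a * \<rho>" "1 / a" "1 / b" "b *\<^sub>R j"] assms False by simp
  also have "(1 / a) * \<bar>(1 / b) / (1 / a)\<bar> powr p = 1 / (a * \<bar>b / a\<bar> powr p)"
    using assms False by (simp add: powr_divide)
  finally have "a * \<bar>b / a\<bar> powr p * g \<rho> j \<le> g (a * \<rho>) (b *\<^sub>R j)"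
    using assms False by (simp add: field_simps)
  then show ?thesis
    using g_scale_le[OF assms, of b j] by simp
qed

lemma g_one_scale: "g 1 (b *\<^sub>R j) = \<bar>b\<bar> powr p * g 1 j"
  using g_scale[of 1 1 b j] by simp

lemma g_eq:
  assumes "0 < \<rho>"
  shows "g \<rho> j = g 1 j / \<rho> powr (p - 1)"
proof -
  have "g \<rho> j = \<rho> * \<bar>1 / \<rho>\<bar> powr p * g 1 j"
    using g_scale[of 1 \<rho> 1 j] assms by simp
  then show ?thesis
    using assms by (simp add: powr_divide powr_diff)
qed

lemma g_one_eq_0_iff: "g 1 j = 0 \<longleftrightarrow> j = 0"
proof
  assume "j = 0"
  then show "g 1 j = 0"
    using g_one_scale[of 0 j] by simp
next
  assume j: "g 1 j = 0"
  obtain c C where c: "0 < c" "\<And>j. ereal (c * norm j - C) \<le> f_hom E F 1 j"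
    using f_hom_coercive by blast
  show "j = 0"
  proof (rule ccontr)
    assume "j \<noteq> 0"
    \<comment> \<open>The multiple of \<open>j\<close> at which the linear lower bound is at least one.\<close>
    let ?b = "(\<bar>C\<bar> + 1) / (c * norm j)"
    have "c * norm (?b *\<^sub>R j) = \<bar>C\<bar> + 1"
      using c(1) \<open>j \<noteq> 0\<close> by simp
    moreover have "c * norm (?b *\<^sub>R j) - C \<le> g 1 (?b *\<^sub>R j)"
      using c(2)[of "?b *\<^sub>R j"] by (simp add: f_hom_eq)
    ultimately show False
      using g_one_scale[of ?b j] j by simp
  qed
qed

section \<open>The norm\<close>

definition N :: "real ^ 'd \<Rightarrow> real" where
  "N j = g 1 j powr (1 / p)"

lemma N_powr: "N j powr p = g 1 j"
  using g_nonneg[of 1 j] p_ge_1 by (simp add: N_def powr_powr)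

lemma N_nonneg: "0 \<le> N j"
  by (simp add: N_def)

lemma N_eq_0_iff: "N j = 0 \<longleftrightarrow> j = 0"
  by (simp add: N_def g_one_eq_0_iff)

lemma N_scale: "N (a *\<^sub>R j) = \<bar>a\<bar> * N j"
  using p_ge_1 g_nonneg[of 1 j] by (simp add: N_def g_one_scale powr_mult powr_powr)

lemma N_triangle: "N (j + j') \<le> N j + N j'"
proof (cases "j = 0 \<or> j' = 0")
  case True
  then show ?thesis
    using N_nonneg by (auto simp: N_eq_0_iff)
next
  case False
  define s where "s = N j + N j'"
  have pos: "0 < N j" "0 < N j'"
    using False N_nonneg[of j] N_nonneg[of j'] N_eq_0_iff[of j] N_eq_0_iff[of j'] by auto
  then have s: "0 < s"
    by (simp add: s_def)
  \<comment> \<open>The cost of carrying \<open>i\<close> with the share \<open>N i / s\<close> of the unit mass.\<close>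
  have cost: "g (N i / s) i = N i * s powr (p - 1)" if "0 < N i" for i
  proof -
    have "g (N i / s) i = N i powr p / (N i / s) powr (p - 1)"
      using that s by (simp add: g_eq[of "N i / s"] N_powr)
    also have "\<dots> = N i * s powr (p - 1)"
      using powr_mult_base[of "N i" "p - 1"] that s by (simp add: powr_divide field_simps)
    finally show ?thesis .
  qed
  have "N j / s + N j' / s = 1"
    using s by (simp add: s_def add_divide_distrib[symmetric])
  then have "g 1 (j + j') \<le> g (N j / s) j + g (N j' / s) j'"
    using g_add_le[of "N j / s" "N j' / s" j j'] pos s by simp
  also have "\<dots> = s * s powr (p - 1)"
    using cost[OF pos(1)] cost[OF pos(2)] by (simp only: s_def distrib_right)
  also have "\<dots> = s powr p"
    using powr_mult_base[of s "p - 1"] s by simp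
  finally have "g 1 (j + j') powr (1 / p) \<le> (s powr p) powr (1 / p)"
    using g_nonneg p_ge_1 by (intro powr_mono2) auto
  then show ?thesis
    using s p_ge_1 by (simp add: N_def[of "j + j'"] powr_powr s_def)
qed

lemma is_norm_N: "is_norm N"
  by (simp add: is_norm_def N_nonneg N_eq_0_iff N_scale N_triangle)

lemma f_hom_eq_norm:
  assumes "0 < \<rho>"
  shows "f_hom E F \<rho> j = ereal (N j powr p / \<rho> powr (p - 1))"
  using assms by (simp add: f_hom_eq g_eq[OF assms] N_powr)

end

theorem corollary5p3:
  fixes E :: "('d::finite, 'v::finite) vertex rel"
    and F :: "('d, 'v) cost"
    and p :: real
  assumes "periodic_graph E"
    and "admissible_cost E F"
    and "1 \<le> p"
    and "\<And>m J l. m \<in> masses \<Longrightarrow> J \<in> flows E \<Longrightarrow> 0 \<le> l \<Longrightarrow>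
           F (\<lambda>x. l * m x, \<lambda>e. l * J e) = ereal l * F (m, J)"
    and "\<And>m J l. m \<in> masses \<Longrightarrow> J \<in> flows E \<Longrightarrow>
           F (m, \<lambda>e. l * J e) = ereal (\<bar>l\<bar> powr p) * F (m, J)"
  shows "\<exists>N :: real ^ 'd \<Rightarrow> real. is_norm N \<and>
           (\<forall>\<rho> j. 0 < \<rho> \<longrightarrow> f_hom E F \<rho> j = ereal (N j powr p / \<rho> powr (p - 1)))"
proof -
  interpret homogeneous_cost E F p
    using assms by unfold_locales
  show ?thesis
    using is_norm_N f_hom_eq_norm by blast
qed

end
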